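(* Let $(\mathbf{A},\tau)$ be an $n$-subtractive $T_0$-topological algebra. Then: (i) $a\in\Sigma_{\kappa(a)}$ for every $a\in A\setminus\{0\}$; (ii) $R_i\subseteq\Sigma_i$ for every $1\le i\le n-1$; (iii) $\Sigma_{n-1}=A\setminus\{0\}$.
   Context: $\mathbf{A}$ is $n$-subtractive ($n\ge2$) with constant $0$ and binary terms $s_1,\dots,s_{n-1}$ satisfying $s_1(x,x)=0$, $s_j(x,0)=s_{j+1}(x,x)$ ($j=1,\dots,n-2$), $s_{n-1}(x,0)=x$. A topological algebra has a topology making all basic operations continuous; $T_0$ refers to the topology. For $a\in A\setminus\{0\}$, the rank $\kappa(a)$ is the least $k\in\{1,\dots,n-1\}$ with $s_k(a,0)\ne0$. For $0\le i\le n-1$, $R_i=\{a\in A\setminus\{0\}:\kappa(a)\le i\}$ (so $R_0=\emptyset$). For $i\ge1$, $\Sigma_i=\{a\in A:\text{there exist open } U,V \text{ with } a\in U,\ 0\in V,\ U\cap V\subseteq R_{i-1}\}$. *)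

theory Defs
  imports "HOL-Analysis.Analysis"
begin

text \<open>
  An algebra is given by its carrier \<open>A\<close>, a type \<open>'f\<close> of operation symbols with arities \<open>ar\<close>, and an
  interpretation \<open>I\<close> of the symbols on argument lists. Only the values of \<open>I f\<close> on lists over \<open>A\<close> of
  length \<open>ar f\<close> matter.
\<close>

definition univ_algebra :: "'a set \<Rightarrow> ('f \<Rightarrow> nat) \<Rightarrow> ('f \<Rightarrow> 'a list \<Rightarrow> 'a) \<Rightarrow> bool" where
  "univ_algebra A ar I \<longleftrightarrow> (\<forall>f xs. set xs \<subseteq> A \<and> length xs = ar f \<longrightarrow> I f xs \<in> A)"

definition topological_algebra ::
    "'a set \<Rightarrow> ('f \<Rightarrow> nat) \<Rightarrow> ('f \<Rightarrow> 'a list \<Rightarrow> 'a) \<Rightarrow> 'a topology \<Rightarrow> bool" where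
  "topological_algebra A ar I X \<longleftrightarrow> univ_algebra A ar I \<and> topspace X = A \<and>
     (\<forall>f. continuous_map (product_topology (\<lambda>_. X) {..<ar f}) X (\<lambda>x. I f (map x [0..<ar f])))"

datatype 'f trm = Var nat | Op 'f "'f trm list"

primrec trm_vars :: "'f trm \<Rightarrow> nat set" where
  "trm_vars (Var i) = {i}"
| "trm_vars (Op f ts) = \<Union> (set (map trm_vars ts))"

primrec wf_trm :: "('f \<Rightarrow> nat) \<Rightarrow> 'f trm \<Rightarrow> bool" where
  "wf_trm ar (Var i) \<longleftrightarrow> True"
| "wf_trm ar (Op f ts) \<longleftrightarrow> length ts = ar f \<and> list_all (wf_trm ar) ts"

primrec trm_val :: "('f \<Rightarrow> 'a list \<Rightarrow> 'a) \<Rightarrow> (nat \<Rightarrow> 'a) \<Rightarrow> 'f trm \<Rightarrow> 'a" where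
  "trm_val I e (Var i) = e i"
| "trm_val I e (Op f ts) = I f (map (trm_val I e) ts)"

definition binary_trm :: "('f \<Rightarrow> nat) \<Rightarrow> 'f trm \<Rightarrow> bool" where
  "binary_trm ar t \<longleftrightarrow> wf_trm ar t \<and> trm_vars t \<subseteq> {0, 1}"

definition binary_val :: "('f \<Rightarrow> 'a list \<Rightarrow> 'a) \<Rightarrow> 'f trm \<Rightarrow> 'a \<Rightarrow> 'a \<Rightarrow> 'a" where
  "binary_val I t x y = trm_val I (\<lambda>i. if i = 0 then x else y) t"

text \<open>The constant is the nullary operation symbol \<open>c\<close>; its value in the algebra is \<open>I c []\<close>.
  The terms are \<open>s 1, \<dots>, s (n - 1)\<close>; other values of \<open>s\<close> are irrelevant.\<close>

definition n_subtractive ::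
    "nat \<Rightarrow> 'a set \<Rightarrow> ('f \<Rightarrow> nat) \<Rightarrow> ('f \<Rightarrow> 'a list \<Rightarrow> 'a) \<Rightarrow> 'f \<Rightarrow> (nat \<Rightarrow> 'f trm) \<Rightarrow> bool" where
  "n_subtractive n A ar I c s \<longleftrightarrow>
     n \<ge> 2 \<and> univ_algebra A ar I \<and> ar c = 0 \<and>
     (\<forall>j\<in>{1..n - 1}. binary_trm ar (s j)) \<and>
     (\<forall>x\<in>A. binary_val I (s 1) x x = I c []) \<and>
     (\<forall>j\<in>{1..n - 2}. \<forall>x\<in>A.
        binary_val I (s j) x (I c []) = binary_val I (s (j + 1)) x x) \<and>
     (\<forall>x\<in>A. binary_val I (s (n - 1)) x (I c []) = x)"

definition sub_rank ::
    "nat \<Rightarrow> ('f \<Rightarrow> 'a list \<Rightarrow> 'a) \<Rightarrow> 'f \<Rightarrow> (nat \<Rightarrow> 'f trm) \<Rightarrow> 'a \<Rightarrow> nat" where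
  "sub_rank n I c s a =
     (LEAST k. k \<in> {1..n - 1} \<and> binary_val I (s k) a (I c []) \<noteq> I c [])"

definition rank_le_set ::
    "nat \<Rightarrow> 'a set \<Rightarrow> ('f \<Rightarrow> 'a list \<Rightarrow> 'a) \<Rightarrow> 'f \<Rightarrow> (nat \<Rightarrow> 'f trm) \<Rightarrow> nat \<Rightarrow> 'a set" where
  "rank_le_set n A I c s i = {a \<in> A - {I c []}. sub_rank n I c s a \<le> i}"

text \<open>The set \<open>\<Sigma>\<^sub>i\<close>, meant for \<open>i \<ge> 1\<close> only.\<close>

definition sigma_set ::
    "nat \<Rightarrow> 'a set \<Rightarrow> ('f \<Rightarrow> 'a list \<Rightarrow> 'a) \<Rightarrow> 'f \<Rightarrow> (nat \<Rightarrow> 'f trm) \<Rightarrow> 'a topology \<Rightarrow> nat \<Rightarrow> 'a set" where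
  "sigma_set n A I c s X i =
     {a \<in> A. \<exists>U V. openin X U \<and> openin X V \<and> a \<in> U \<and> I c [] \<in> V \<and>
                 U \<inter> V \<subseteq> rank_le_set n A I c s (i - 1)}"

end

theory Submission
  imports Defs
begin

text \<open>
  If \<open>x\<close> is zero or has rank at least \<open>k\<close>, then \<open>s k x x = 0\<close>. Hence for nonzero \<open>b\<close> of rank \<open>m\<close> we have
  \<open>s m b b = 0\<close> and \<open>s m b 0 \<noteq> 0\<close>. The \<open>T\<^sub>0\<close> axiom separates \<open>s m b 0\<close> from \<open>0\<close> on one side; pulling
  back along \<open>y \<mapsto> s m y 0\<close> or \<open>y \<mapsto> s m b y\<close>, according to the side, yields in both cases an open set
  containing \<open>b\<close> but not \<open>0\<close>. Apply this to \<open>b = s k a 0\<close>, where \<open>k\<close> is the rank of \<open>a\<close>, to get \<open>W\<close>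
  open with \<open>s k a 0 \<in> W\<close> and \<open>0 \<notin> W\<close>. By continuity \<open>s k\<close> maps some \<open>U \<times> V\<close> into \<open>W\<close>, where \<open>a \<in> U\<close>
  and \<open>0 \<in> V\<close>. For \<open>x \<in> U \<inter> V\<close> then \<open>s k x x \<noteq> 0\<close>, so \<open>x\<close> is nonzero of rank less than \<open>k\<close>.
\<close>

text \<open>Induction on the term: the subterms give a continuous map into a power of
  \<open>X\<close>, which is composed with the basic operation. The free source \<open>Y\<close>
  serves both for a term with one argument frozen and for the joint map on the square of
  \<open>X\<close>.\<close>

lemma continuous_map_trm_val:
  assumes alg: "topological_algebra A ar I X"
    and e: "\<And>i. continuous_map Y X (\<lambda>z. e z i)"
    and wf: "wf_trm ar t"
  shows "continuous_map Y X (\<lambda>z. trm_val I (e z) t)"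
  using wf
proof (induction t)
  case (Var i)
  show ?case using e by simp
next
  case (Op f ts)
  have len: "length ts = ar f" and wfs: "\<And>t. t \<in> set ts \<Longrightarrow> wf_trm ar t"
    using Op.prems by (auto simp: list_all_iff)
  \<comment> \<open>Restricted because points of the product topology are extensional; the argument
    list reads only indices below \<open>ar f\<close>.\<close>
  let ?g = "\<lambda>z. \<lambda>i\<in>{..<ar f}. trm_val I (e z) (ts ! i)"
  have "continuous_map Y (product_topology (\<lambda>_. X) {..<ar f}) ?g"
    using Op.IH wfs len by (auto simp: continuous_map_componentwise)
  moreover have "continuous_map (product_topology (\<lambda>_. X) {..<ar f}) X (\<lambda>x. I f (map x [0..<ar f]))"
    using alg by (auto simp: topological_algebra_def)
  ultimately have "continuous_map Y X ((\<lambda>x. I f (map x [0..<ar f])) \<circ> ?g)"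
    by (rule continuous_map_compose)
  moreover have "map (?g z) [0..<ar f] = map (trm_val I (e z)) ts" for z
    by (rule nth_equalityI) (simp_all add: len)
  ultimately show ?case
    by (simp add: o_def)
qed

lemma continuous_map_binary_val:
  assumes "topological_algebra A ar I X" "binary_trm ar t"
    and "continuous_map Y X g" "continuous_map Y X h"
  shows "continuous_map Y X (\<lambda>z. binary_val I t (g z) (h z))"
  unfolding binary_val_def
  by (rule continuous_map_trm_val[OF assms(1)])
    (use assms in \<open>simp_all add: binary_trm_def\<close>)

lemma n_subtractive_const_in_carrier:
  assumes "n_subtractive n A ar I c s"
  shows "I c [] \<in> A"
  using assms unfolding n_subtractive_def univ_algebra_def by (metis empty_set empty_subsetI list.size(3))

text \<open>At \<open>x = 0\<close> the chain identities link the values \<open>s j 0 0\<close> for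
  successive \<open>j\<close>, starting from \<open>s 1 0 0 = 0\<close>.\<close>

lemma binary_val_const_const:
  assumes sub: "n_subtractive n A ar I c s" and j: "1 \<le> j" "j \<le> n - 1"
  shows "binary_val I (s j) (I c []) (I c []) = I c []"
  using j
proof (induction j rule: dec_induct)
  case base
  show ?case using sub n_subtractive_const_in_carrier[OF sub] by (simp add: n_subtractive_def)
next
  case (step j)
  then have "j \<in> {1..n - 2}" by auto
  then show ?case
    using step sub n_subtractive_const_in_carrier[OF sub] by (simp add: n_subtractive_def)
qed

text \<open>The index \<open>n - 1\<close> always qualifies, since \<open>s (n - 1) a 0 = a\<close>
  is nonzero; so the \<open>LEAST\<close> is attained.\<close>

lemma
  assumes "n_subtractive n A ar I c s" "a \<in> A" "a \<noteq> I c []"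
  shows sub_rank_bounds: "sub_rank n I c s a \<in> {1..n - 1}"
    and binary_val_sub_rank: "binary_val I (s (sub_rank n I c s a)) a (I c []) \<noteq> I c []"
proof -
  let ?P = "\<lambda>k. k \<in> {1..n - 1} \<and> binary_val I (s k) a (I c []) \<noteq> I c []"
  have "?P (n - 1)"
    using assms by (auto simp: n_subtractive_def)
  then have "?P (LEAST k. ?P k)"
    by (rule LeastI)
  then show "sub_rank n I c s a \<in> {1..n - 1}"
    and "binary_val I (s (sub_rank n I c s a)) a (I c []) \<noteq> I c []"
    by (simp_all add: sub_rank_def)
qed

lemma binary_val_diagonal_eq_const:
  assumes sub: "n_subtractive n A ar I c s" and x: "x \<in> A" and k: "k \<in> {1..n - 1}"
    and notin: "x \<notin> rank_le_set n A I c s (k - 1)"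
  shows "binary_val I (s k) x x = I c []"
proof (cases "x = I c []")
  case True
  then show ?thesis using binary_val_const_const[OF sub] k by simp
next
  case False
  then have rank: "k - 1 < sub_rank n I c s x"
    using notin x by (auto simp: rank_le_set_def)
  show ?thesis
  proof (cases "k = 1")
    case True
    then show ?thesis using sub x by (simp add: n_subtractive_def)
  next
    case False
    then have "k - 1 \<in> {1..n - 2}" and [simp]: "k - 1 + 1 = k" using k by auto
    then have "binary_val I (s k) x x = binary_val I (s (k - 1)) x (I c [])"
      using sub x unfolding n_subtractive_def by metis
    \<comment> \<open>The index \<open>k - 1\<close> is in range and below the rank of
      \<open>x\<close>, so minimality forces the value to be zero.\<close>
    also have "\<dots> = I c []"
      using not_less_Least[OF rank[unfolded sub_rank_def]] \<open>k - 1 \<in> {1..n - 2}\<close> by auto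
    finally show ?thesis .
  qed
qed

lemma binary_val_diagonal_sub_rank:
  assumes "n_subtractive n A ar I c s" "a \<in> A" "a \<noteq> I c []"
  shows "binary_val I (s (sub_rank n I c s a)) a a = I c []"
proof (rule binary_val_diagonal_eq_const[OF assms(1,2) sub_rank_bounds[OF assms]])
  show "a \<notin> rank_le_set n A I c s (sub_rank n I c s a - 1)"
    using sub_rank_bounds[OF assms] by (auto simp: rank_le_set_def)
qed

lemma open_nbhd_avoiding_const:
  assumes sub: "n_subtractive n A ar I c s" and alg: "topological_algebra A ar I X"
    and t0: "t0_space X" and b: "b \<in> A" "b \<noteq> I c []"
  obtains W where "openin X W" "b \<in> W" "I c [] \<notin> W"
proof -
  define m where "m = sub_rank n I c s b"
  define d where "d = binary_val I (s m) b (I c [])"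
  have m: "m \<in> {1..n - 1}" and d: "d \<noteq> I c []" and diag: "binary_val I (s m) b b = I c []"
    using sub_rank_bounds[OF sub b] binary_val_sub_rank[OF sub b] binary_val_diagonal_sub_rank[OF sub b]
    by (auto simp: m_def d_def)
  have A: "topspace X = A" and zero: "I c [] \<in> A"
    using alg n_subtractive_const_in_carrier[OF sub] by (auto simp: topological_algebra_def)
  have "binary_trm ar (s m)"
    using sub m by (auto simp: n_subtractive_def)
  note cont = continuous_map_binary_val[OF alg this]
  have left: "continuous_map X X (\<lambda>y. binary_val I (s m) y (I c []))"
    and right: "continuous_map X X (\<lambda>y. binary_val I (s m) b y)"
    by (rule cont; simp add: A b zero)+
  have "d \<in> A"
    using left b A unfolding d_def continuous_map_def by auto
  then obtain W where W: "openin X W" "d \<in> W \<longleftrightarrow> I c [] \<notin> W"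
    using t0 d zero A unfolding t0_space_def by metis
  show thesis
  proof (cases "d \<in> W")
    \<comment> \<open>The preimage contains \<open>b\<close>, which is sent to \<open>d\<close>, and
      misses 0 because \<open>s m 0 0 = 0\<close>.\<close>
    case True
    show thesis
    proof (rule that)
      show "openin X {y \<in> topspace X. binary_val I (s m) y (I c []) \<in> W}"
        using left W(1) by (rule openin_continuous_map_preimage)
    qed (use True W m b A binary_val_const_const[OF sub] in \<open>auto simp: d_def\<close>)
  next
    \<comment> \<open>Now \<open>W\<close> contains 0 but not \<open>d\<close>:
      \<open>s m b b = 0\<close> puts \<open>b\<close> into the preimage, and
      \<open>s m b 0 = d\<close> keeps 0 out.\<close>
    case False
    show thesis
    proof (rule that)
      show "openin X {y \<in> topspace X. binary_val I (s m) b y \<in> W}"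
        using right W(1) by (rule openin_continuous_map_preimage)
    qed (use False W b A diag in \<open>auto simp: d_def\<close>)
  qed
qed

lemma in_sigma_set_sub_rank:
  assumes sub: "n_subtractive n A ar I c s" and alg: "topological_algebra A ar I X"
    and t0: "t0_space X" and a: "a \<in> A" "a \<noteq> I c []"
  shows "a \<in> sigma_set n A I c s X (sub_rank n I c s a)"
proof -
  define k where "k = sub_rank n I c s a"
  define b where "b = binary_val I (s k) a (I c [])"
  have k: "k \<in> {1..n - 1}" and b: "b \<noteq> I c []"
    using sub_rank_bounds[OF sub a] binary_val_sub_rank[OF sub a] by (auto simp: k_def b_def)
  have A: "topspace X = A" and zero: "I c [] \<in> A"
    using alg n_subtractive_const_in_carrier[OF sub] by (auto simp: topological_algebra_def)
  let ?h = "\<lambda>z. binary_val I (s k) (fst z) (snd z)"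
  have "binary_trm ar (s k)"
    using sub k by (auto simp: n_subtractive_def)
  then have cont: "continuous_map (prod_topology X X) X ?h"
    by (rule continuous_map_binary_val[OF alg _ continuous_map_fst continuous_map_snd])
  have "(a, I c []) \<in> topspace (prod_topology X X)"
    using a zero A by simp
  then have "b \<in> A"
    using continuous_map_image_subset_topspace[OF cont] A unfolding b_def by (metis fst_conv image_subset_iff snd_conv)
  then obtain W where W: "openin X W" "b \<in> W" "I c [] \<notin> W"
    using open_nbhd_avoiding_const[OF sub alg t0] b by blast
  let ?P = "{z \<in> topspace (prod_topology X X). ?h z \<in> W}"
  have "openin (prod_topology X X) ?P" and "(a, I c []) \<in> ?P"
    using openin_continuous_map_preimage[OF cont W(1)] W(2) a zero A by (auto simp: b_def)
  then obtain U V where UV: "openin X U" "openin X V" "a \<in> U" "I c [] \<in> V" "U \<times> V \<subseteq> ?P"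
    unfolding openin_prod_topology_alt by meson
  have "x \<in> rank_le_set n A I c s (k - 1)" if "x \<in> U \<inter> V" for x
  proof (rule ccontr)
    assume notin: "x \<notin> rank_le_set n A I c s (k - 1)"
    \<comment> \<open>The diagonal turns the box \<open>U \<times> V\<close> into a condition on
      \<open>U \<inter> V\<close>.\<close>
    have "(x, x) \<in> ?P"
      using that UV(5) by blast
    then show False
      using binary_val_diagonal_eq_const[OF sub _ k notin] A W(3) by simp
  qed
  then show ?thesis
    unfolding sigma_set_def k_def[symmetric] using a UV(1-4) by blast
qed

lemma sigma_set_mono:
  assumes "i \<le> j"
  shows "sigma_set n A I c s X i \<subseteq> sigma_set n A I c s X j"
proof -
  have "rank_le_set n A I c s (i - 1) \<subseteq> rank_le_set n A I c s (j - 1)"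
    using assms by (auto simp: rank_le_set_def)
  then show ?thesis
    unfolding sigma_set_def by blast
qed

theorem theorem6p18:
  fixes n :: nat and A :: "'a set" and ar :: "'f \<Rightarrow> nat" and I :: "'f \<Rightarrow> 'a list \<Rightarrow> 'a"
    and c :: 'f and s :: "nat \<Rightarrow> 'f trm" and X :: "'a topology"
  assumes "n_subtractive n A ar I c s"
    and "topological_algebra A ar I X"
    and "t0_space X"
  shows "(\<forall>a\<in>A - {I c []}. a \<in> sigma_set n A I c s X (sub_rank n I c s a)) \<and>
         (\<forall>i\<in>{1..n - 1}. rank_le_set n A I c s i \<subseteq> sigma_set n A I c s X i) \<and>
         sigma_set n A I c s X (n - 1) = A - {I c []}"
proof -
  have rank: "a \<in> sigma_set n A I c s X (sub_rank n I c s a)" if "a \<in> A - {I c []}" for a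
    using in_sigma_set_sub_rank[OF assms] that by blast
  have R: "rank_le_set n A I c s i \<subseteq> sigma_set n A I c s X i" for i
  proof
    fix a assume "a \<in> rank_le_set n A I c s i"
    then have "a \<in> A - {I c []}" "sub_rank n I c s a \<le> i"
      by (auto simp: rank_le_set_def)
    then show "a \<in> sigma_set n A I c s X i"
      using subsetD[OF sigma_set_mono rank] by simp
  qed
  have "A - {I c []} \<subseteq> rank_le_set n A I c s (n - 1)"
    using sub_rank_bounds[OF assms(1)] by (auto simp: rank_le_set_def)
  \<comment> \<open>If 0 were in the set, it would lie in \<open>U \<inter> V\<close>, hence in a
    rank set, and these exclude 0. A nonzero rank bound plays no part here.\<close>
  moreover have "sigma_set n A I c s X (n - 1) \<subseteq> A - {I c []}"
    by (auto simp: sigma_set_def rank_le_set_def)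
  ultimately show ?thesis
    using rank R by (meson subset_antisym subset_trans)
qed

end
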